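(* Let $a,b,n\ge 1$ be integers. The Horadam cube $\Pi^{a,b}_n$ can be decomposed into $F_{n+1}$ grids, i.e. its vertex set can be partitioned into $F_{n+1}$ nonempty sets, each of which induces a subgraph of $\Pi^{a,b}_n$ isomorphic to a grid. Moreover, let $\Pi^{a,b}_n/\rho$ be the quotient graph obtained from $\Pi^{a,b}_n$ by identifying all vertices having the same image under $\rho$, where two distinct vertices $w_1,w_2$ of $\Pi^{a,b}_n/\rho$ (regarded as elements of the image of $\rho$) are adjacent if and only if there is at least one edge of $\Pi^{a,b}_n$ connecting a vertex of $\rho^{-1}(w_1)$ with a vertex of $\rho^{-1}(w_2)$. Then $\Pi^{a,b}_n/\rho$ is isomorphic to the Fibonacci cube $\Gamma_{n-1}$.
   Context: For integers $a,b\ge1$ and $n\ge 0$, $\mathcal S^{a,b}_n$ is the set of all strings of length $n$ over the alphabet $\{0,1,\dots,a+b-1\}$ in which every letter from $\{a,\dots,a+b-1\}$ appears only immediately after a letter $0$. The Horadam cube $\Pi^{a,b}_n$ is the simple graph with vertex set $\mathcal S^{a,b}_n$ in which $x_1\cdots x_n$ and $y_1\cdots y_n$ are adjacent if and only if $\sum_{i=1}^n|x_i-y_i|=1$. A Fibonacci string of length $n$ is a binary string of length $n$ with no two consecutive $1$s; the Fibonacci cube $\Gamma_n$ is the graph on the Fibonacci strings of length $n$, two being adjacent if they differ in exactly one position ($\Gamma_0$ is a single vertex). $F_n$ is the $n$-th Fibonacci number, $F_0=0$, $F_1=1$, $F_n=F_{n-1}+F_{n-2}$, so there are $F_{n+2}$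 Fibonacci strings of length $n$. The map $\rho$ from $V(\Pi^{a,b}_n)$ to Fibonacci strings of length $n$ is applied letter by letter: $\rho(x)=0$ if $0\le x\le a-1$ and $\rho(x)=1$ if $x\ge a$. $P_m$ is the path graph with $m$ vertices. A grid is a Cartesian product of path graphs. *)

theory Defs
  imports
    "HOL-Library.Disjoint_Sets"
    "HOL-Number_Theory.Fib"
    "Graph_Theory.Graph_Theory"
begin

text \<open>
  A simple graph is a \<^locale>\<open>pair_graph\<close>: a finite, loop-free, symmetric set of arcs,
  so that each edge is represented by its two orientations. The string
  $x_1 \ldots x_n$ is a list \<open>xs\<close> of length \<open>n\<close>, with $x_i$ being \<open>xs ! (i - 1)\<close>.
\<close>

definition horadam_strings :: "nat \<Rightarrow> nat \<Rightarrow> nat \<Rightarrow> nat list set" where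
  "horadam_strings a b n =
    {xs. length xs = n \<and> set xs \<subseteq> {..<a + b} \<and>
         (\<forall>i<n. a \<le> xs ! i \<longrightarrow> 0 < i \<and> xs ! (i - 1) = 0)}"

definition horadam_cube :: "nat \<Rightarrow> nat \<Rightarrow> nat \<Rightarrow> nat list pair_pre_digraph" where
  "horadam_cube a b n =
    \<lparr> pverts = horadam_strings a b n,
      parcs = {(xs, ys). xs \<in> horadam_strings a b n \<and> ys \<in> horadam_strings a b n \<and>
                         (\<Sum>i<n. \<bar>int (xs ! i) - int (ys ! i)\<bar>) = 1} \<rparr>"

definition fibonacci_strings :: "nat \<Rightarrow> nat list set" where
  "fibonacci_strings n =
    {xs. length xs = n \<and> set xs \<subseteq> {0, 1} \<and>
         (\<forall>i. Suc i < n \<longrightarrow> \<not> (xs ! i = 1 \<and> xs ! Suc i = 1))}"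

definition fibonacci_cube :: "nat \<Rightarrow> nat list pair_pre_digraph" where
  "fibonacci_cube n =
    \<lparr> pverts = fibonacci_strings n,
      parcs = {(xs, ys). xs \<in> fibonacci_strings n \<and> ys \<in> fibonacci_strings n \<and>
                         card {i. i < n \<and> xs ! i \<noteq> ys ! i} = 1} \<rparr>"

definition rho :: "nat \<Rightarrow> nat list \<Rightarrow> nat list" where
  "rho a = map (\<lambda>x. if x < a then 0 else 1)"

definition path_graph :: "nat \<Rightarrow> nat pair_pre_digraph" where
  "path_graph m =
    \<lparr> pverts = {..<m}, parcs = {(u, v). u < m \<and> v < m \<and> (v = Suc u \<or> u = Suc v)} \<rparr>"

text \<open>The Cartesian product of a list of graphs, with tuples of vertices represented as lists.\<close>

definition cartesian_product :: "'a pair_pre_digraph list \<Rightarrow> 'a list pair_pre_digraph" where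
  "cartesian_product Gs =
    \<lparr> pverts = listset (map pverts Gs),
      parcs = {(us, vs). us \<in> listset (map pverts Gs) \<and> vs \<in> listset (map pverts Gs) \<and>
                (\<exists>i<length Gs. (us ! i, vs ! i) \<in> parcs (Gs ! i) \<and>
                   (\<forall>j<length Gs. j \<noteq> i \<longrightarrow> us ! j = vs ! j))} \<rparr>"

definition is_grid :: "('a, 'b) pre_digraph \<Rightarrow> bool" where
  "is_grid G \<longleftrightarrow>
    (\<exists>ms. ms \<noteq> [] \<and> (\<forall>m\<in>set ms. 1 \<le> m) \<and>
          digraph_iso G (with_proj (cartesian_product (map path_graph ms))))"

definition quotient_graph :: "'a pair_pre_digraph \<Rightarrow> ('a \<Rightarrow> 'c) \<Rightarrow> 'c pair_pre_digraph" where
  "quotient_graph G f =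
    \<lparr> pverts = f ` pverts G,
      parcs = {(w1, w2). w1 \<noteq> w2 \<and> (\<exists>(u, v)\<in>parcs G. f u = w1 \<and> f v = w2)} \<rparr>"

lemma finite_horadam_strings: "finite (horadam_strings a b n)"
  by (rule finite_subset[OF _ finite_lists_length_eq[of "{..<a + b}" n]])
    (auto simp: horadam_strings_def)

lemma finite_fibonacci_strings: "finite (fibonacci_strings n)"
  by (rule finite_subset[OF _ finite_lists_length_eq[of "{0, 1}" n]])
    (auto simp: fibonacci_strings_def)

lemma pair_graph_horadam_cube: "pair_graph (horadam_cube a b n)"
proof
  show "finite (parcs (horadam_cube a b n))"
    by (rule finite_subset[OF _ finite_cartesian_product[OF finite_horadam_strings[of a b n]
          finite_horadam_strings[of a b n]]]) (auto simp: horadam_cube_def)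
qed (auto simp: horadam_cube_def finite_horadam_strings symmetric_def
    intro!: symI simp: abs_minus_commute)

lemma pair_graph_fibonacci_cube: "pair_graph (fibonacci_cube n)"
proof
  show "finite (parcs (fibonacci_cube n))"
    by (rule finite_subset[OF _ finite_cartesian_product[OF finite_fibonacci_strings[of n]
          finite_fibonacci_strings[of n]]]) (auto simp: fibonacci_cube_def)
  show "symmetric (with_proj (fibonacci_cube n))"
    unfolding symmetric_def by (intro symI) (simp add: fibonacci_cube_def eq_commute)
qed (auto simp: fibonacci_cube_def finite_fibonacci_strings)

lemma pair_graph_path_graph: "pair_graph (path_graph m)"
proof
  show "finite (parcs (path_graph m))"
    by (rule finite_subset[of _ "{..<m} \<times> {..<m}"]) (auto simp: path_graph_def)
qed (auto simp: path_graph_def symmetric_def intro!: symI)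

end

theory Submission
  imports Defs
begin

text \<open>
  A string lies over \<open>w\<close> under \<open>\<rho>\<close> iff each of its letters lies in an interval that depends on \<open>w\<close>
  only: \<open>{a..<a + b}\<close> where \<open>w\<close> has a \<open>1\<close>, \<open>{0}\<close> where the next letter of \<open>w\<close> is a \<open>1\<close>, and
  \<open>{..<a}\<close> elsewhere. So the fibres of \<open>\<rho>\<close> are grids. The image of \<open>\<rho>\<close> consists of the Fibonacci
  strings that begin with \<open>0\<close>, and dropping this \<open>0\<close> gives all Fibonacci strings of length \<open>n - 1\<close>.
  If two strings in the image differ in one position only, then the letters \<open>a - 1\<close> and \<open>a\<close> in
  that position give an edge between the two fibres.
\<close>

section \<open>Isomorphisms of digraphs whose arcs are pairs of vertices\<close>

text \<open>A digraph isomorphism also carries a map on arcs. When arcs are pairs, a vertex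
  bijection \<open>f\<close> forces that map to be \<open>map_prod f f\<close>, so only adjacency
  has to be compared.\<close>

lemma digraph_isoI:
  assumes "bij_betw f (verts G) (verts H)"
    and "tail G = fst" "head G = snd" "tail H = fst" "head H = snd"
    and "arcs G \<subseteq> verts G \<times> verts G" "arcs H \<subseteq> verts H \<times> verts H"
    and arc: "\<And>u v. u \<in> verts G \<Longrightarrow> v \<in> verts G \<Longrightarrow> (u, v) \<in> arcs G \<longleftrightarrow> (f u, f v) \<in> arcs H"
  shows "digraph_iso G H"
proof -
  let ?h = "\<lparr>iso_verts = f, iso_arcs = map_prod f f, iso_head = snd, iso_tail = fst\<rparr>"
  have inj: "inj_on f (verts G)" and surj: "f ` verts G = verts H"
    using assms(1) by (auto simp: bij_betw_def)
  have "inj_on (map_prod f f) (arcs G)"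
    using map_prod_inj_on[OF inj inj] assms(6) by (rule inj_on_subset)
  moreover have "wf_digraph G"
    using assms(2,3,6) by unfold_locales auto
  ultimately have "pre_digraph.digraph_isomorphism G ?h"
    using inj assms(2,3) by (auto simp: pre_digraph.digraph_isomorphism_def)
  moreover have "map_prod f f ` arcs G = arcs H"
  proof
    show "map_prod f f ` arcs G \<subseteq> arcs H"
      using arc assms(6) by auto
    show "arcs H \<subseteq> map_prod f f ` arcs G"
    proof clarify
      fix x y assume xy: "(x, y) \<in> arcs H"
      then obtain u v where uv: "u \<in> verts G" "v \<in> verts G" "x = f u" "y = f v"
        using assms(7) surj by blast
      then show "(x, y) \<in> map_prod f f ` arcs G"
        using xy arc by (intro image_eqI[of _ _ "(u, v)"]) auto
    qed
  qed
  \<comment> \<open>\<open>digraph_iso\<close> asks for \<open>H\<close> to equal the image of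
    \<open>G\<close> as a record, so \<open>tail\<close> and \<open>head\<close> must agree as
    well.\<close>
  then have "H = app_iso ?h G"
    using surj assms(4,5) by (auto simp: app_iso_def intro: pre_digraph.equality)
  ultimately show ?thesis
    unfolding digraph_iso_def by blast
qed

section \<open>Positionwise descriptions of tuples and strings\<close>

lemma listset_conv_nth:
  "xs \<in> listset As \<longleftrightarrow> length xs = length As \<and> (\<forall>i<length As. xs ! i \<in> As ! i)"
proof (induction As arbitrary: xs)
  case (Cons A As)
  then show ?case
    by (cases xs) (auto simp: set_Cons_def nth_Cons' less_Suc_eq_0_disj)
qed auto

lemma horadam_strings_iff:
  "xs \<in> horadam_strings a b n \<longleftrightarrow>
    length xs = n \<and> (\<forall>i<n. xs ! i < a + b \<and> (a \<le> xs ! i \<longrightarrow> 0 < i \<and> xs ! (i - 1) = 0))"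
  by (auto simp: horadam_strings_def subset_iff in_set_conv_nth)

text \<open>For binary letters, excluding two adjacent 1s means that each adjacent pair contains a
  0. This form yields the 0 next to a given 1 directly.\<close>

lemma fibonacci_strings_iff:
  "w \<in> fibonacci_strings n \<longleftrightarrow>
    length w = n \<and> (\<forall>i<n. w ! i = 0 \<or> w ! i = 1) \<and>
    (\<forall>i. Suc i < n \<longrightarrow> w ! i = 0 \<or> w ! Suc i = 0)"
proof -
  have "set w \<subseteq> {0, 1} \<longleftrightarrow> (\<forall>i<n. w ! i = 0 \<or> w ! i = 1)" if "length w = n"
    using that by (auto simp: subset_iff in_set_conv_nth)
  moreover have "\<not> (w ! i = 1 \<and> w ! Suc i = 1) \<longleftrightarrow> w ! i = 0 \<or> w ! Suc i = 0"
    if "\<forall>i<n. w ! i = 0 \<or> w ! i = 1" "Suc i < n" for i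
    using that(1)[rule_format, of i] that(1)[rule_format, of "Suc i"] that(2) by auto
  ultimately show ?thesis
    unfolding fibonacci_strings_def mem_Collect_eq by (meson Suc_lessD)
qed

section \<open>Counting Fibonacci strings\<close>

text \<open>Serves both the recursion of the count and the removal of a leading 0. The case
  \<open>n = 0\<close> stands apart because \<open>w ! 0\<close> is then unspecified.\<close>

lemma Cons_in_fibonacci_strings:
  "c # w \<in> fibonacci_strings (Suc n) \<longleftrightarrow>
    (c = 0 \<or> c = 1) \<and> w \<in> fibonacci_strings n \<and> (c = 0 \<or> n = 0 \<or> w ! 0 = 0)"
proof (cases n)
  case (Suc m)
  have adj: "(\<forall>i. Suc i < Suc n \<longrightarrow> (c # w) ! i = 0 \<or> (c # w) ! Suc i = 0) \<longleftrightarrow>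
      (c = 0 \<or> w ! 0 = 0) \<and> (\<forall>i. Suc i < n \<longrightarrow> w ! i = 0 \<or> w ! Suc i = 0)"
    unfolding Suc Suc_less_eq All_less_Suc2 by simp
  have bin: "(\<forall>i<Suc n. (c # w) ! i = 0 \<or> (c # w) ! i = 1) \<longleftrightarrow>
      (c = 0 \<or> c = 1) \<and> (\<forall>i<n. w ! i = 0 \<or> w ! i = 1)"
    unfolding All_less_Suc2 by simp
  have "n \<noteq> 0" using Suc by simp
  then show ?thesis
    unfolding fibonacci_strings_iff adj bin length_Cons nat.inject by (simp only: simp_thms conj_ac)
qed (auto simp: fibonacci_strings_iff)

text \<open>The Fibonacci recurrence: a leading 0 may be followed by any Fibonacci string, while a
  leading 1 must be followed by a 0 and then by any Fibonacci string.\<close>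

lemma card_fibonacci_strings: "card (fibonacci_strings n) = fib (n + 2)"
proof (induction n rule: fib.induct)
  case 1
  have "fibonacci_strings 0 = {[]}"
    by (auto simp: fibonacci_strings_iff)
  then show ?case by simp
next
  case 2
  have "fibonacci_strings (Suc 0) = {[0], [1]}"
    by (auto simp: fibonacci_strings_iff length_Suc_conv)
  then show ?case by (simp add: numeral_eq_Suc)
next
  case (3 n)
  let ?A = "Cons 0 ` fibonacci_strings (Suc n)" and ?B = "(\<lambda>w. 1 # 0 # w) ` fibonacci_strings n"
  have "fibonacci_strings (Suc (Suc n)) = ?A \<union> ?B"
  proof (intro equalityI subsetI)
    fix w assume w: "w \<in> fibonacci_strings (Suc (Suc n))"
    then obtain x y u where "w = x # y # u"
      by (auto simp: fibonacci_strings_def length_Suc_conv)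
    then show "w \<in> ?A \<union> ?B"
      using w by (auto simp: Cons_in_fibonacci_strings)
  qed (auto simp: Cons_in_fibonacci_strings)
  moreover have "card ?A = fib (Suc n + 2)" "card ?B = fib (n + 2)"
    using 3 by (auto simp: card_image inj_on_def)
  moreover have "?A \<inter> ?B = {}" by auto
  ultimately show ?case
    using finite_fibonacci_strings by (simp add: card_Un_disjoint)
qed

section \<open>Edges as unit steps in a single position\<close>

text \<open>Nonnegative integers sum to 1 only if one of them is 1 and the others vanish. The
  right-hand side has the shape of adjacency in a Cartesian product of paths.\<close>

lemma sum_abs_diff_eq_1_iff:
  fixes xs ys :: "nat list"
  shows "(\<Sum>i<n. \<bar>int (xs ! i) - int (ys ! i)\<bar>) = 1 \<longleftrightarrow>
    (\<exists>i<n. (xs ! i = Suc (ys ! i) \<or> ys ! i = Suc (xs ! i)) \<and> (\<forall>j<n. j \<noteq> i \<longrightarrow> xs ! j = ys ! j))"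
proof -
  \<comment> \<open>The terms are moved to the naturals, where \<open>sum_eq_1_iff\<close>
    applies.\<close>
  let ?d = "\<lambda>i. nat \<bar>int (xs ! i) - int (ys ! i)\<bar>"
  have sum1: "sum f {..<n} = 1 \<longleftrightarrow> (\<exists>i<n. f i = 1 \<and> (\<forall>j<n. j \<noteq> i \<longrightarrow> f j = 0))"
    for f :: "nat \<Rightarrow> nat"
    using sum_eq_1_iff[of "{..<n}" f] by (simp only: finite_lessThan Bex_def Ball_def lessThan_iff) metis
  have d: "?d i = 1 \<longleftrightarrow> xs ! i = Suc (ys ! i) \<or> ys ! i = Suc (xs ! i)"
    "?d i = 0 \<longleftrightarrow> xs ! i = ys ! i" for i
    by linarith+
  have "(\<Sum>i<n. \<bar>int (xs ! i) - int (ys ! i)\<bar>) = int (\<Sum>i<n. ?d i)"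
    by simp
  then have "(\<Sum>i<n. \<bar>int (xs ! i) - int (ys ! i)\<bar>) = 1 \<longleftrightarrow> (\<Sum>i<n. ?d i) = 1"
    by linarith
  also have "\<dots> \<longleftrightarrow> (\<exists>i<n. ?d i = 1 \<and> (\<forall>j<n. j \<noteq> i \<longrightarrow> ?d j = 0))"
    by (rule sum1)
  also have "\<dots> \<longleftrightarrow> (\<exists>i<n. (xs ! i = Suc (ys ! i) \<or> ys ! i = Suc (xs ! i)) \<and>
      (\<forall>j<n. j \<noteq> i \<longrightarrow> xs ! j = ys ! j))"
    unfolding d ..
  finally show ?thesis .
qed

section \<open>The map \<open>rho\<close>, a section of it, and its image\<close>

lemma length_rho [simp]: "length (rho a xs) = length xs"
  by (simp add: rho_def)

lemma nth_rho: "i < length xs \<Longrightarrow> rho a xs ! i = (if xs ! i < a then 0 else 1)"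
  by (simp add: rho_def)

text \<open>A section of \<open>rho a\<close> over the strings in its image: each letter is the
  smallest one with the prescribed image.\<close>

definition lift :: "nat \<Rightarrow> nat list \<Rightarrow> nat list" where
  "lift a = map (\<lambda>c. if c = 0 then 0 else a)"

lemma length_lift [simp]: "length (lift a w) = length w"
  by (simp add: lift_def)

lemma nth_lift: "i < length w \<Longrightarrow> lift a w ! i = (if w ! i = 0 then 0 else a)"
  by (simp add: lift_def)

context
  fixes a b n :: nat
  assumes a: "a \<ge> 1" and b: "b \<ge> 1" and n: "n \<ge> 1"
begin

abbreviation base :: "nat list set" where
  "base \<equiv> {w \<in> fibonacci_strings n. w ! 0 = 0}"

text \<open>A letter that is at least \<open>a\<close> follows a 0, which is below \<open>a\<close>
  since \<open>a\<close> is positive; hence no two 1s are adjacent in the image. The first letter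
  has no predecessor, so it is below \<open>a\<close>.\<close>

lemma rho_in_base:
  assumes "xs \<in> horadam_strings a b n"
  shows "rho a xs \<in> base"
proof -
  have "xs ! i < a \<or> xs ! Suc i < a" if "Suc i < n" for i
    using assms that a unfolding horadam_strings_iff
    by (metis Suc_le_eq diff_Suc_1 linorder_not_less One_nat_def)
  moreover have "xs ! 0 < a"
    using assms n unfolding horadam_strings_iff by (metis Suc_le_eq One_nat_def not_le less_irrefl)
  ultimately show ?thesis
    using assms n by (auto simp: fibonacci_strings_iff nth_rho horadam_strings_iff)
qed

lemma rho_lift: "w \<in> base \<Longrightarrow> rho a (lift a w) = w"
proof (rule nth_equalityI)
  fix i assume w: "w \<in> base" and "i < length (rho a (lift a w))"
  then have i: "i < length w" by simp
  then have "w ! i = 0 \<or> w ! i = 1" using w unfolding fibonacci_strings_iff by blast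
  then show "rho a (lift a w) ! i = w ! i" using i a by (auto simp: nth_rho nth_lift)
qed simp

lemma base_before_1:
  assumes "w \<in> base" "i < n" "w ! i \<noteq> 0"
  shows "0 < i" "w ! (i - 1) = 0"
proof -
  show "0 < i" using assms by (cases i) auto
  then have "Suc (i - 1) = i" by simp
  then show "w ! (i - 1) = 0" using assms unfolding fibonacci_strings_iff mem_Collect_eq by metis
qed

text \<open>Each 1 of \<open>w\<close> has a 0 before it, and this 0 lifts to the letter 0 that must
  precede \<open>a\<close>. The letter \<open>a\<close> itself exists because \<open>b\<close> is
  positive.\<close>

lemma lift_in_horadam_strings:
  assumes w: "w \<in> base"
  shows "lift a w \<in> horadam_strings a b n"
proof -
  have "length w = n" using w by (simp add: fibonacci_strings_iff)
  then show ?thesis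
    using base_before_1[OF w] a b by (auto simp: horadam_strings_iff nth_lift)
qed

lemma rho_image: "rho a ` horadam_strings a b n = base"
proof
  show "rho a ` horadam_strings a b n \<subseteq> base"
    by (rule image_subsetI) (rule rho_in_base)
  show "base \<subseteq> rho a ` horadam_strings a b n"
  proof
    fix w assume "w \<in> base"
    then show "w \<in> rho a ` horadam_strings a b n"
      using lift_in_horadam_strings rho_lift by (intro image_eqI[of _ _ "lift a w"]) simp_all
  qed
qed

section \<open>The fibres of \<open>rho\<close> as boxes\<close>

text \<open>The number of letters allowed in position \<open>i\<close> of a string over
  \<open>w\<close>. The guard \<open>Suc i < n\<close> is there because the last position has no
  successor.\<close>

definition fibre_dim :: "nat list \<Rightarrow> nat \<Rightarrow> nat" where
  "fibre_dim w i = (if w ! i = 1 then b else if Suc i < n \<and> w ! Suc i = 1 then 1 else a)"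

text \<open>Once \<open>w\<close> is fixed, the condition linking neighbouring letters decouples: it
  only forces a 0 before each 1 of \<open>w\<close>. The lower end \<open>w ! i * a\<close> is 0 or
  \<open>a\<close>.\<close>

lemma fibre_iff:
  assumes w: "w \<in> base"
  shows "xs \<in> horadam_strings a b n \<and> rho a xs = w \<longleftrightarrow>
    length xs = n \<and> (\<forall>i<n. w ! i * a \<le> xs ! i \<and> xs ! i < w ! i * a + fibre_dim w i)"
    (is "?L \<longleftrightarrow> ?R")
proof
  have lw: "length w = n" and w01: "\<And>i. i < n \<Longrightarrow> w ! i = 0 \<or> w ! i = 1"
    using w by (auto simp: fibonacci_strings_iff)
  show ?R if L: ?L
  proof (intro conjI allI impI)
    show len: "length xs = n" using L by (simp add: horadam_strings_iff)
    fix i assume i: "i < n"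
    have wi: "w ! j = (if xs ! j < a then 0 else 1)" if "j < n" for j
      using L len that nth_rho by blast
    show "w ! i * a \<le> xs ! i" using wi[OF i] by auto
    have xs: "xs ! j < a + b" "a \<le> xs ! j \<Longrightarrow> xs ! (j - 1) = 0" if "j < n" for j
      using L that unfolding horadam_strings_iff by blast+
    \<comment> \<open>This is the forced position, where the interval has length 1.\<close>
    have "xs ! i = 0" if "Suc i < n" "w ! Suc i = 1"
    proof -
      have "a \<le> xs ! Suc i" using that(2) wi[OF that(1)] by (metis not_le zero_neq_one)
      then show ?thesis using xs(2)[OF that(1)] by simp
    qed
    then show "xs ! i < w ! i * a + fibre_dim w i"
      using xs(1)[OF i] wi[OF i] by (simp add: fibre_dim_def split: if_splits)
  qed
  show ?L if R: ?R
  proof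
    have xs: "w ! i * a \<le> xs ! i" "xs ! i < w ! i * a + fibre_dim w i" if "i < n" for i
      using R that by blast+
    \<comment> \<open>The length is \<open>a\<close> or 1, and \<open>1 \<le> a\<close> settles the
      second case.\<close>
    have low: "xs ! i < a" if "i < n" "w ! i = 0" for i
      using xs(2)[OF that(1)] that(2) a by (simp add: fibre_dim_def split: if_splits)
    have high: "a \<le> xs ! i" "xs ! i < a + b" if "i < n" "w ! i = 1" for i
      using xs[OF that(1)] that(2) by (simp_all add: fibre_dim_def)
    \<comment> \<open>Before a 1 of \<open>w\<close> the interval starts at 0 and has length 1, so
      it is \<open>{0}\<close>.\<close>
    have zero: "xs ! (i - 1) = 0" "0 < i" if "i < n" "w ! i = 1" for i
    proof -
      show "0 < i" using base_before_1[OF w] that by simp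
      have "w ! (i - 1) = 0" using base_before_1[OF w] that by simp
      then have "fibre_dim w (i - 1) = 1" using that \<open>0 < i\<close> by (simp add: fibre_dim_def)
      then show "xs ! (i - 1) = 0" using xs(2)[of "i - 1"] \<open>w ! (i - 1) = 0\<close> that by simp
    qed
    show "rho a xs = w"
    proof (rule nth_equalityI)
      fix i assume "i < length (rho a xs)"
      then have "i < n" "i < length xs" using R by auto
      then show "rho a xs ! i = w ! i"
        using w01[of i] low[of i] high(1)[of i] by (auto simp: nth_rho)
    qed (use R lw in simp)
    have "xs ! i < a + b \<and> (a \<le> xs ! i \<longrightarrow> 0 < i \<and> xs ! (i - 1) = 0)" if "i < n" for i
      using w01[OF that] low[OF that] high(2)[OF that] zero[OF that] by auto
    then show "xs \<in> horadam_strings a b n" using R by (simp add: horadam_strings_iff)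
  qed
qed

section \<open>Edges of the quotient graph\<close>

lemma edge_between_fibres:
  assumes v: "v \<in> base" and w: "w \<in> base" and i: "i < n" "v ! i = 0" "w ! i = 1"
    and eq: "\<And>j. j < n \<Longrightarrow> j \<noteq> i \<Longrightarrow> v ! j = w ! j"
  obtains xs ys where "(xs, ys) \<in> parcs (horadam_cube a b n)" "rho a xs = v" "rho a ys = w"
proof -
  \<comment> \<open>Position \<open>i\<close> of \<open>lift a w\<close> holds \<open>a\<close>.
    Raising the 0 of \<open>lift a v\<close> there to \<open>a - 1\<close> brings the two strings to
    distance 1.\<close>
  let ?xs = "(lift a v)[i := a - 1]"
  have len: "length v = n" "length w = n"
    using v w by (auto simp: fibonacci_strings_iff)
  \<comment> \<open>Raising the letter in position \<open>i\<close> is harmless only if the next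
    letter needs no 0 before it. Here \<open>w\<close> has a 1 at \<open>i\<close>, hence a 0 after
    it, and \<open>v\<close> agrees with \<open>w\<close> there.\<close>
  have next_0: "v ! Suc i = 0" if "Suc i < n"
    using w i eq that by (force simp: fibonacci_strings_iff)
  have "(\<Sum>j<n. \<bar>int (?xs ! j) - int (lift a w ! j)\<bar>) = 1"
    unfolding sum_abs_diff_eq_1_iff using a i len eq
    by (intro exI[of _ i]) (auto simp: nth_list_update nth_lift)
  moreover have "?xs \<in> horadam_strings a b n \<and> rho a ?xs = v"
    unfolding fibre_iff[OF v]
  proof (intro conjI allI impI)
    fix j assume j: "j < n"
    have "v ! j * a \<le> lift a v ! j \<and> lift a v ! j < v ! j * a + fibre_dim v j"
      using fibre_iff[OF v, of "lift a v"] lift_in_horadam_strings[OF v] rho_lift[OF v] j by blast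
    then show "v ! j * a \<le> ?xs ! j" "?xs ! j < v ! j * a + fibre_dim v j"
      using next_0 i len j a by (auto simp: nth_list_update fibre_dim_def)
  qed (simp add: len)
  ultimately show thesis
    using that[of ?xs "lift a w"] lift_in_horadam_strings[OF w] rho_lift[OF w]
    by (simp add: horadam_cube_def)
qed

lemma parcs_horadam_cube_sym:
  "(xs, ys) \<in> parcs (horadam_cube a b n) \<Longrightarrow> (ys, xs) \<in> parcs (horadam_cube a b n)"
  by (simp add: horadam_cube_def abs_minus_commute)

text \<open>An edge changes one letter, so the images differ in at most one position, and in at
  least one as they are distinct. The converse is \<open>edge_between_fibres\<close>, up to
  exchanging the two strings.\<close>

lemma quotient_arc_iff:
  assumes v: "v \<in> base" and w: "w \<in> base"
  shows "(v, w) \<in> parcs (quotient_graph (horadam_cube a b n) (rho a)) \<longleftrightarrow>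
    card {i. i < n \<and> v ! i \<noteq> w ! i} = 1" (is "?L \<longleftrightarrow> ?R")
proof
  assume ?L
  then obtain xs ys where vw: "v \<noteq> w" "rho a xs = v" "rho a ys = w"
    and xy: "xs \<in> horadam_strings a b n" "ys \<in> horadam_strings a b n"
    and "(\<Sum>i<n. \<bar>int (xs ! i) - int (ys ! i)\<bar>) = 1"
    by (auto simp: quotient_graph_def horadam_cube_def)
  then obtain i where i: "i < n" "\<forall>j<n. j \<noteq> i \<longrightarrow> xs ! j = ys ! j"
    unfolding sum_abs_diff_eq_1_iff by blast
  have len: "length xs = n" "length ys = n"
    using xy by (auto simp: horadam_strings_iff)
  then have "v ! j = w ! j" if "j < n" "j \<noteq> i" for j
    using that i vw by (auto simp: nth_rho)
  moreover from this have "v ! i \<noteq> w ! i"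
    using vw len by (metis length_rho nth_equalityI)
  ultimately have "{i. i < n \<and> v ! i \<noteq> w ! i} = {i}"
    using i by auto
  then show ?R by simp
next
  assume ?R
  then obtain i where "{i. i < n \<and> v ! i \<noteq> w ! i} = {i}"
    by (auto simp: card_1_singleton_iff)
  then have i: "i < n" "v ! i \<noteq> w ! i" and eq: "\<And>j. j < n \<Longrightarrow> j \<noteq> i \<Longrightarrow> v ! j = w ! j"
    by blast+
  have "v ! i = 0 \<or> v ! i = 1" "w ! i = 0 \<or> w ! i = 1"
    using v w i by (auto simp: fibonacci_strings_iff)
  then consider "v ! i = 0" "w ! i = 1" | "w ! i = 0" "v ! i = 1"
    using i by fastforce
  then obtain xs ys where "(xs, ys) \<in> parcs (horadam_cube a b n)" "rho a xs = v" "rho a ys = w"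
  proof cases
    case 1
    then show ?thesis
      using edge_between_fibres[OF v w i(1)] eq that by metis
  next
    case 2
    then show ?thesis
      using edge_between_fibres[OF w v i(1)] eq parcs_horadam_cube_sym that by metis
  qed
  then show ?L
    using i by (auto simp: quotient_graph_def)
qed

section \<open>Removing the leading 0: the quotient is a Fibonacci cube\<close>

text \<open>The inverse prepends a 0, which never creates adjacent 1s.\<close>

lemma bij_betw_tl_base: "bij_betw tl base (fibonacci_strings (n - 1))"
proof (rule bij_betwI[where g = "Cons 0"])
  obtain m where m: "n = Suc m" using n by (cases n) auto
  have base: "\<exists>u. w = 0 # u \<and> u \<in> fibonacci_strings (n - 1)" if "w \<in> base" for w
  proof (cases w)
    case Nil
    then show ?thesis using that m by (simp add: fibonacci_strings_def)
  next
    case (Cons c u)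
    then show ?thesis using that m by (simp add: Cons_in_fibonacci_strings)
  qed
  then show "tl \<in> base \<rightarrow> fibonacci_strings (n - 1)"
    by fastforce
  show "0 # tl w = w" if "w \<in> base" for w
    using base[OF that] by auto
  show "Cons 0 \<in> fibonacci_strings (n - 1) \<rightarrow> base"
    using m by (simp add: Cons_in_fibonacci_strings)
qed simp

lemma quotient_iso_fibonacci_cube:
  "digraph_iso (with_proj (quotient_graph (horadam_cube a b n) (rho a)))
    (with_proj (fibonacci_cube (n - 1)))"
proof (rule digraph_isoI[of tl])
  have verts: "verts (with_proj (quotient_graph (horadam_cube a b n) (rho a))) = base"
    using rho_image by (simp add: quotient_graph_def horadam_cube_def)
  then show "bij_betw tl (verts (with_proj (quotient_graph (horadam_cube a b n) (rho a))))
      (verts (with_proj (fibonacci_cube (n - 1))))"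
    using bij_betw_tl_base by (simp add: fibonacci_cube_def)
  fix v w
  assume "v \<in> verts (with_proj (quotient_graph (horadam_cube a b n) (rho a)))"
    and "w \<in> verts (with_proj (quotient_graph (horadam_cube a b n) (rho a)))"
  then have v: "v \<in> base" and w: "w \<in> base"
    unfolding verts by auto
  have len: "length v = n" "length w = n"
    using v w by (auto simp: fibonacci_strings_iff)
  \<comment> \<open>Both strings begin with 0, so position 0 never counts and the other positions
    shift by one.\<close>
  have "{i. i < n \<and> v ! i \<noteq> w ! i} = Suc ` {i. i < n - 1 \<and> tl v ! i \<noteq> tl w ! i}" (is "?A = Suc ` ?B")
  proof
    show "?A \<subseteq> Suc ` ?B"
    proof
      fix i assume "i \<in> ?A"
      moreover from this have "i \<noteq> 0" using v w by (cases i) auto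
      ultimately show "i \<in> Suc ` ?B"
        using len by (intro image_eqI[of _ _ "i - 1"]) (auto simp: nth_tl)
    qed
    show "Suc ` ?B \<subseteq> ?A" using len by (auto simp: nth_tl)
  qed
  then have "card ?A = card ?B" by (simp add: card_image)
  moreover have "tl v \<in> fibonacci_strings (n - 1)" "tl w \<in> fibonacci_strings (n - 1)"
    using bij_betw_tl_base v w by (auto dest: bij_betwE)
  ultimately show "(v, w) \<in> arcs (with_proj (quotient_graph (horadam_cube a b n) (rho a))) \<longleftrightarrow>
      (tl v, tl w) \<in> arcs (with_proj (fibonacci_cube (n - 1)))"
    using quotient_arc_iff[OF v w] by (simp add: fibonacci_cube_def)
qed (auto simp: quotient_graph_def horadam_cube_def fibonacci_cube_def)

section \<open>Fibres as grids, and the resulting partition\<close>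

text \<open>Translating the box of \<open>fibre_iff\<close> to the origin turns each interval into
  the vertex set of a path and preserves unit steps.\<close>

lemma fibre_iso_grid:
  assumes w: "w \<in> base"
  defines "S \<equiv> {xs \<in> horadam_strings a b n. rho a xs = w}"
  obtains ms where "ms \<noteq> []" "\<forall>m\<in>set ms. 1 \<le> m"
    "digraph_iso (induce_subgraph (with_proj (horadam_cube a b n)) S)
      (with_proj (cartesian_product (map path_graph ms)))"
proof -
  define ms where "ms = map (fibre_dim w) [0..<n]"
  have ms: "length ms = n" "\<And>i. i < n \<Longrightarrow> ms ! i = fibre_dim w i"
    by (auto simp: ms_def)
  \<comment> \<open>Truncated subtraction is exact on \<open>S\<close>, where
    \<open>w ! i * a\<close> is a lower bound.\<close>
  define f where "f xs = map (\<lambda>i. xs ! i - w ! i * a) [0..<n]" for xs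
  have f: "length (f xs) = n" "\<And>i. i < n \<Longrightarrow> f xs ! i = xs ! i - w ! i * a" for xs
    by (auto simp: f_def)
  have S: "xs \<in> S \<longleftrightarrow> length xs = n \<and> (\<forall>i<n. w ! i * a \<le> xs ! i \<and> xs ! i < w ! i * a + fibre_dim w i)"
    for xs using fibre_iff[OF w] by (simp add: S_def)
  let ?T = "listset (map pverts (map path_graph ms))"
  have T: "ys \<in> ?T \<longleftrightarrow> length ys = n \<and> (\<forall>i<n. ys ! i < fibre_dim w i)" for ys
    by (auto simp: listset_conv_nth ms path_graph_def)
  have bij: "bij_betw f S ?T"
  proof (rule bij_betwI[where g = "\<lambda>ys. map (\<lambda>i. w ! i * a + ys ! i) [0..<n]"])
    show "f \<in> S \<rightarrow> ?T"
    proof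
      fix xs assume "xs \<in> S"
      then show "f xs \<in> ?T" unfolding T S using f by (auto simp: less_diff_conv2 add.commute)
    qed
    show "(\<lambda>ys. map (\<lambda>i. w ! i * a + ys ! i) [0..<n]) \<in> ?T \<rightarrow> S"
    proof
      fix ys assume "ys \<in> ?T"
      then show "map (\<lambda>i. w ! i * a + ys ! i) [0..<n] \<in> S" unfolding T S by auto
    qed
    show "map (\<lambda>i. w ! i * a + f xs ! i) [0..<n] = xs" if "xs \<in> S" for xs
      using that by (intro nth_equalityI) (auto simp: S f)
    show "f (map (\<lambda>i. w ! i * a + ys ! i) [0..<n]) = ys" if "ys \<in> ?T" for ys
      using that unfolding T by (intro nth_equalityI) (auto simp: f)
  qed
  have "digraph_iso (induce_subgraph (with_proj (horadam_cube a b n)) S)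
          (with_proj (cartesian_product (map path_graph ms)))"
  proof (rule digraph_isoI[of f])
    show "bij_betw f (verts (induce_subgraph (with_proj (horadam_cube a b n)) S))
            (verts (with_proj (cartesian_product (map path_graph ms))))"
      using bij by (simp add: cartesian_product_def)
    fix xs ys
    assume "xs \<in> verts (induce_subgraph (with_proj (horadam_cube a b n)) S)"
      and "ys \<in> verts (induce_subgraph (with_proj (horadam_cube a b n)) S)"
    then have xy: "xs \<in> S" "ys \<in> S" by auto
    then have fT: "f xs \<in> ?T" "f ys \<in> ?T" using bij by (auto simp: bij_betw_def)
    have bounds: "w ! i * a \<le> xs ! i" "w ! i * a \<le> ys ! i"
      "f xs ! i < fibre_dim w i" "f ys ! i < fibre_dim w i" if "i < n" for i
      using xy fT that unfolding S T by blast+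
    have step: "xs ! i = Suc (ys ! i) \<longleftrightarrow> f xs ! i = Suc (f ys ! i)"
      "ys ! i = Suc (xs ! i) \<longleftrightarrow> f ys ! i = Suc (f xs ! i)"
      "xs ! i = ys ! i \<longleftrightarrow> f xs ! i = f ys ! i" if "i < n" for i
      using bounds(1,2)[OF that] by (simp_all add: f(2)[OF that]) arith+
    have path: "(f xs ! i, f ys ! i) \<in> parcs (map path_graph ms ! i) \<longleftrightarrow>
        f xs ! i = Suc (f ys ! i) \<or> f ys ! i = Suc (f xs ! i)" if "i < n" for i
      using bounds[OF that] that by (auto simp: ms path_graph_def)
    have "(xs, ys) \<in> arcs (induce_subgraph (with_proj (horadam_cube a b n)) S) \<longleftrightarrow>
        (\<Sum>i<n. \<bar>int (xs ! i) - int (ys ! i)\<bar>) = 1"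
      using xy by (auto simp: horadam_cube_def S_def)
    also have "\<dots> \<longleftrightarrow> (\<exists>i<n. (f xs ! i = Suc (f ys ! i) \<or> f ys ! i = Suc (f xs ! i)) \<and>
        (\<forall>j<n. j \<noteq> i \<longrightarrow> f xs ! j = f ys ! j))"
      unfolding sum_abs_diff_eq_1_iff using step by (metis (no_types, lifting))
    also have "\<dots> \<longleftrightarrow> (f xs, f ys) \<in> arcs (with_proj (cartesian_product (map path_graph ms)))"
      using fT path by (simp add: cartesian_product_def ms(1) cong: conj_cong)
    finally show "(xs, ys) \<in> arcs (induce_subgraph (with_proj (horadam_cube a b n)) S) \<longleftrightarrow>
        (f xs, f ys) \<in> arcs (with_proj (cartesian_product (map path_graph ms)))" .
  qed (auto simp: cartesian_product_def)
  \<comment> \<open>There is one path per position, including paths with a single vertex at forced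
    positions.\<close>
  moreover have "ms \<noteq> []" "\<forall>m\<in>set ms. 1 \<le> m"
    using n a b by (auto simp: ms_def fibre_dim_def)
  ultimately show thesis
    using that by blast
qed

lemma horadam_cube_grid_partition:
  obtains P where "partition_on (pverts (horadam_cube a b n)) P" "card P = fib (n + 1)"
    "\<forall>S\<in>P. is_grid (induce_subgraph (with_proj (horadam_cube a b n)) S)"
proof -
  let ?S = "\<lambda>w. {xs \<in> horadam_strings a b n. rho a xs = w}"
  \<comment> \<open>Writing \<open>base\<close> as the image of \<open>rho a\<close> makes every
    block nonempty, which also gives the injectivity of \<open>?S\<close> below.\<close>
  have "partition_on (horadam_strings a b n) (?S ` base)"
    unfolding rho_image[symmetric] by (rule partition_onI) (auto simp: disjnt_def)
  moreover have "inj_on ?S base"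
    unfolding rho_image[symmetric] by (rule inj_onI) blast
  \<comment> \<open>By \<open>bij_betw_tl_base\<close> the blocks number
    \<open>fib (n - 1 + 2)\<close>, which is \<open>fib (n + 1)\<close> because \<open>n\<close> is
    positive.\<close>
  then have "card (?S ` base) = fib (n + 1)"
    using bij_betw_same_card[OF bij_betw_tl_base] n
    by (simp add: card_image card_fibonacci_strings)
  moreover have "\<forall>S\<in>?S ` base. is_grid (induce_subgraph (with_proj (horadam_cube a b n)) S)"
  proof
    fix S assume "S \<in> ?S ` base"
    then obtain w where w: "w \<in> base" "S = ?S w" by blast
    obtain ms where "ms \<noteq> []" "\<forall>m\<in>set ms. 1 \<le> m"
      "digraph_iso (induce_subgraph (with_proj (horadam_cube a b n)) S)
        (with_proj (cartesian_product (map path_graph ms)))"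
      unfolding w(2) by (rule fibre_iso_grid[OF w(1)])
    then show "is_grid (induce_subgraph (with_proj (horadam_cube a b n)) S)"
      unfolding is_grid_def by blast
  qed
  ultimately show thesis
    using that[of "?S ` base"] by (simp add: horadam_cube_def)
qed

end

theorem theorem3:
  fixes a b n :: nat
  assumes "a \<ge> 1" and "b \<ge> 1" and "n \<ge> 1"
  shows "(\<exists>P. partition_on (pverts (horadam_cube a b n)) P \<and> card P = fib (n + 1) \<and>
              (\<forall>S\<in>P. is_grid (induce_subgraph (with_proj (horadam_cube a b n)) S)))
       \<and> digraph_iso (with_proj (quotient_graph (horadam_cube a b n) (rho a)))
                     (with_proj (fibonacci_cube (n - 1)))"
  using horadam_cube_grid_partition[OF assms] quotient_iso_fibonacci_cube[OF assms] by metis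

end
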